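(* For any integers $k \ge 3$ and $l \ge 1$, $$\sigma^*(d(l, k)) = \left\{ 2\sqrt{k-1} \cos\left(\frac{h}{j+1}\pi\right) \colon 1 \le h \le j \le l \right\} \cup \{ x \in \mathbb{R} \colon W_{l, l+1}(x, k) = 0 \},$$ where $h,j$ range over integers. On the other hand, if $k = 2$ and $l \ge 1$, then $$\sigma^*(d(l, 2)) = \left\{ 2\cos\left(\frac{h}{2l+2}\pi\right) \colon 1 \le h \le 2l+1 \right\},$$ where $h$ ranges over integers.
   Context: For a finite simple graph $G$, $\sigma^*(G)$ denotes the set of all distinct eigenvalues of its adjacency matrix. For integers $l\ge 1$ and $k\ge 2$, the dendrimer $d(l,k)$ is the rooted tree with $l+1$ levels numbered $0,\dots,l$ (level $0$ consists of the root, level $l$ consists of the leaves) in which every vertex in levels $0,\dots,l-1$ (the internal vertices) has degree $k$; i.e. the root has $k$ children, every vertex in levels $1,\dots,l-1$ has $k-1$ children, and vertices in level $l$ have no children. The polynomials $W_{l,0}(x,k),\dots,W_{l,l+1}(x,k)$ in $x$ are defined by $W_{l,0}(x,k)=1$, $W_{l,1}(x,k)=x$, $W_{l,j}(x,k)=x\,W_{l,j-1}(x,k)-(k-1)\,W_{l,j-2}(x,k)$ for $2\le j\le l$, and $W_{l,l+1}(x,k)=x\,W_{l,l}(x,k)-k\,W_{l,l-1}(x,k)$. *)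

theory Defs
  imports
    "Jordan_Normal_Form.Spectral_Radius"
    "Graph_Theory.Graph_Theory"
begin

definition adjacency_matrix :: "'a pair_pre_digraph \<Rightarrow> 'a list \<Rightarrow> real mat" where
  "adjacency_matrix G vs =
     mat (length vs) (length vs) (\<lambda>(i, j). if (vs ! i, vs ! j) \<in> parcs G then 1 else 0)"

(* The matrix type has index set {..<n}, so an enumeration of the vertices has to be chosen;
   by sigma_star_enum below, the set obtained does not depend on it. The adjacency matrix of a
   graph is real symmetric, so its complex eigenvalues are the real ones. *)
definition sigma_star :: "'a pair_pre_digraph \<Rightarrow> real set" where
  "sigma_star G = spectrum (adjacency_matrix G (SOME vs. distinct vs \<and> set vs = pverts G))"

(* A vertex at level m is the list of the m child indices chosen on the way down from the root,
   so that [] is the root and the children of p are the vertices of the form p @ [c]. *)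
definition dendrimer_verts :: "nat \<Rightarrow> nat \<Rightarrow> nat list set" where
  "dendrimer_verts l k =
     {p. length p \<le> l \<and> (\<forall>i < length p. p ! i < (if i = 0 then k else k - 1))}"

definition dendrimer :: "nat \<Rightarrow> nat \<Rightarrow> nat list pair_pre_digraph" where
  "dendrimer l k =
     \<lparr> pverts = dendrimer_verts l k,
       parcs = {(p, q). p \<in> dendrimer_verts l k \<and> q \<in> dendrimer_verts l k \<and>
                        ((\<exists>c. q = p @ [c]) \<or> (\<exists>c. p = q @ [c]))} \<rparr>"

(* Only W l k j with j \<le> l + 1 is meaningful. *)
fun W :: "nat \<Rightarrow> nat \<Rightarrow> nat \<Rightarrow> real poly" where
  "W l k 0 = 1"
| "W l k (Suc 0) = [:0, 1:]"
| "W l k (Suc (Suc j)) =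
     [:0, 1:] * W l k (Suc j) - Polynomial.smult (if Suc (Suc j) \<le> l then real k - 1 else real k) (W l k j)"

lemma eigenvalue_adjacency_matrix_iff:
  assumes "distinct vs"
  shows "eigenvalue (adjacency_matrix G vs) x \<longleftrightarrow>
    (\<exists>f. (\<exists>v\<in>set vs. f v \<noteq> 0) \<and>
         (\<forall>v\<in>set vs. (\<Sum>w\<in>{w\<in>set vs. (v, w) \<in> parcs G}. f w) = x * f v))"
proof -
  let ?n = "length vs"
  let ?A = "adjacency_matrix G vs"
  have sum_eq: "(\<Sum>j<?n. ?A $$ (i, j) * g (vs ! j)) = (\<Sum>w\<in>{w\<in>set vs. (vs ! i, w) \<in> parcs G}. g w)"
    if "i < ?n" for i and g :: "'a \<Rightarrow> real"
  proof -
    have "(\<Sum>w\<in>{w\<in>set vs. (vs ! i, w) \<in> parcs G}. g w)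
        = (\<Sum>w\<in>set vs. if (vs ! i, w) \<in> parcs G then g w else 0)"
      by (simp add: sum.inter_filter)
    also have "\<dots> = (\<Sum>j<?n. if (vs ! i, vs ! j) \<in> parcs G then g (vs ! j) else 0)"
      by (rule sum.reindex_bij_betw[OF bij_betw_nth[OF assms refl refl], symmetric])
    also have "\<dots> = (\<Sum>j<?n. ?A $$ (i, j) * g (vs ! j))"
      using that by (intro sum.cong) (auto simp: adjacency_matrix_def)
    finally show ?thesis by simp
  qed
  have mult_eq: "(?A *\<^sub>v u) $ i = (\<Sum>j<?n. ?A $$ (i, j) * u $ j)"
    if "i < ?n" "u \<in> carrier_vec ?n" for i u
    using that by (simp add: adjacency_matrix_def scalar_prod_def lessThan_atLeast0)
  show ?thesis
  proof
    assume "eigenvalue ?A x"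
    then obtain u where u: "u \<in> carrier_vec ?n" "u \<noteq> 0\<^sub>v ?n" "?A *\<^sub>v u = x \<cdot>\<^sub>v u"
      by (auto simp: eigenvalue_def eigenvector_def adjacency_matrix_def)
    define f where "f v = u $ (THE i. i < ?n \<and> vs ! i = v)" for v
    have f: "f (vs ! i) = u $ i" if "i < ?n" for i
    proof -
      have "(THE j. j < ?n \<and> vs ! j = vs ! i) = i"
        using that assms by (auto intro!: the_equality simp: nth_eq_iff_index_eq)
      then show ?thesis by (simp add: f_def)
    qed
    obtain i where i: "i < ?n" "u $ i \<noteq> 0"
      using u(1,2) by (metis carrier_vecD eq_vecI index_zero_vec)
    have "(\<Sum>w\<in>{w\<in>set vs. (vs ! i, w) \<in> parcs G}. f w) = x * f (vs ! i)" if "i < ?n" for i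
      using sum_eq[OF that, of f] mult_eq[OF that u(1)] u(1,3) that by (simp add: f)
    then show "\<exists>f. (\<exists>v\<in>set vs. f v \<noteq> 0) \<and>
         (\<forall>v\<in>set vs. (\<Sum>w\<in>{w\<in>set vs. (v, w) \<in> parcs G}. f w) = x * f v)"
      using i f by (intro exI[of _ f] conjI ballI bexI[of _ "vs ! i"]) (auto simp: in_set_conv_nth)
  next
    assume "\<exists>f. (\<exists>v\<in>set vs. f v \<noteq> 0) \<and>
         (\<forall>v\<in>set vs. (\<Sum>w\<in>{w\<in>set vs. (v, w) \<in> parcs G}. f w) = x * f v)"
    then obtain f where f: "\<exists>v\<in>set vs. f v \<noteq> 0"
      "\<And>v. v \<in> set vs \<Longrightarrow> (\<Sum>w\<in>{w\<in>set vs. (v, w) \<in> parcs G}. f w) = x * f v"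
      by blast
    define u where "u = vec ?n (\<lambda>i. f (vs ! i))"
    have u: "u \<in> carrier_vec ?n" by (simp add: u_def)
    obtain i where "i < ?n" "f (vs ! i) \<noteq> 0" using f(1) by (metis in_set_conv_nth)
    then have "u \<noteq> 0\<^sub>v ?n" by (metis u_def index_vec index_zero_vec(1))
    moreover have "?A *\<^sub>v u = x \<cdot>\<^sub>v u"
    proof (rule eq_vecI)
      show "dim_vec (?A *\<^sub>v u) = dim_vec (x \<cdot>\<^sub>v u)" by (simp add: u_def adjacency_matrix_def)
      fix i assume "i < dim_vec (x \<cdot>\<^sub>v u)"
      then have i: "i < ?n" by (simp add: u_def)
      have "(?A *\<^sub>v u) $ i = (\<Sum>j<?n. ?A $$ (i, j) * f (vs ! j))"
        unfolding mult_eq[OF i u] by (intro sum.cong) (auto simp: u_def)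
      then show "(?A *\<^sub>v u) $ i = (x \<cdot>\<^sub>v u) $ i"
        using sum_eq[OF i, of f] f(2)[of "vs ! i"] i by (simp add: u_def)
    qed
    ultimately show "eigenvalue ?A x"
      using u by (auto simp: eigenvalue_def eigenvector_def adjacency_matrix_def)
  qed
qed

lemma sigma_star_enum:
  assumes "distinct vs" "set vs = pverts G"
  shows "sigma_star G = spectrum (adjacency_matrix G vs)"
proof -
  define us where "us = (SOME vs. distinct vs \<and> set vs = pverts G)"
  have "distinct us \<and> set us = pverts G"
    unfolding us_def by (rule someI[of _ vs]) (use assms in simp)
  then show ?thesis
    using assms
    unfolding sigma_star_def us_def[symmetric] spectrum_def
    by (intro Collect_cong) (simp add: eigenvalue_adjacency_matrix_iff)
qed

lemma finite_dendrimer_verts: "finite (dendrimer_verts l k)"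
proof (rule finite_subset)
  show "dendrimer_verts l k \<subseteq> {p. set p \<subseteq> {..<k} \<and> length p \<le> l}"
  proof
    fix p assume p: "p \<in> dendrimer_verts l k"
    have "p ! i < k" if "i < length p" for i
    proof -
      have "p ! i < (if i = 0 then k else k - 1)"
        using p that by (simp add: dendrimer_verts_def)
      then show ?thesis by (simp split: if_splits)
    qed
    then show "p \<in> {p. set p \<subseteq> {..<k} \<and> length p \<le> l}"
      using p by (auto simp: dendrimer_verts_def in_set_conv_nth)
  qed
  show "finite {p. set p \<subseteq> {..<k} \<and> length p \<le> l}"
    by (rule finite_lists_length_le) simp
qed

lemma pair_graph_dendrimer: "pair_graph (dendrimer l k)"
proof
  show "finite (parcs (dendrimer l k))"
    by (rule finite_subset[of _ "dendrimer_verts l k \<times> dendrimer_verts l k"])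
       (auto simp: dendrimer_def finite_dendrimer_verts)
qed (auto simp: dendrimer_def finite_dendrimer_verts symmetric_def sym_def)

lemma snoc_in_dendrimer_verts:
  "p @ [c] \<in> dendrimer_verts l k \<longleftrightarrow>
     p \<in> dendrimer_verts l k \<and> length p < l \<and> c < (if p = [] then k else k - 1)"
  by (auto simp: dendrimer_verts_def nth_append less_Suc_eq split: if_splits)

lemma degree_dendrimer:
  assumes "p \<in> dendrimer_verts l k" "k \<ge> 1"
  shows "card {q. (p, q) \<in> parcs (dendrimer l k)} =
           (if length p < l then k else if p = [] then 0 else 1)"
proof -
  define C where "C = (\<lambda>c. p @ [c]) ` {c. length p < l \<and> c < (if p = [] then k else k - 1)}"
  define P where "P = (if p = [] then {} else {butlast p})"
  have "q \<in> P \<longleftrightarrow> (\<exists>c. p = q @ [c])" for q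
    by (auto simp: P_def) (metis append_butlast_last_id)
  moreover have "butlast p \<in> dendrimer_verts l k"
    using assms(1) by (auto simp: dendrimer_verts_def nth_butlast)
  ultimately have "{q. (p, q) \<in> parcs (dendrimer l k)} = C \<union> P"
    using assms(1)
    by (auto simp: dendrimer_def C_def snoc_in_dendrimer_verts simp del: append.simps)
  moreover have "C \<inter> P = {}"
  proof -
    have "length q > length p" if "q \<in> C" for q using that by (auto simp: C_def)
    moreover have "length q \<le> length p" if "q \<in> P" for q
      using that by (auto simp: P_def split: if_splits)
    ultimately show ?thesis by (metis disjoint_iff not_le)
  qed
  moreover have "card C = card {c. length p < l \<and> c < (if p = [] then k else k - 1)}"
    unfolding C_def by (rule card_image) (auto simp: inj_on_def)
  moreover have "finite C" "finite P" by (auto simp: C_def P_def)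
  ultimately have "card {q. (p, q) \<in> parcs (dendrimer l k)} =
      card {c. length p < l \<and> c < (if p = [] then k else k - 1)} + card P"
    by (simp add: card_Un_disjoint)
  then show ?thesis using assms(2) by (auto simp: P_def)
qed

end

(* An eigenfunction f of the dendrimer for the eigenvalue x can be solved from the leaves upwards:
   W_(j+1)(x) f(v) = W_j(x) f(parent of v) at every vertex v of level l - j > 0, and
   W_(l+1)(x) f(root) = 0.  Looking at a vertex of minimal level where f does not vanish,
   x is a root of W_(l+1) or of some W_j with 1 \<le> j \<le> l.  Conversely, level-wise constant functions
   realise the roots of W_(l+1), and functions supported with opposite signs on two sibling branches
   realise the roots of W_j.  The roots of W_j follow from
   W_j(2 sqrt(k-1) cos t) sin t = sqrt(k-1)^j sin((j+1) t) by counting.  If k = 2, only the root has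
   two children, so only W_l and W_(l+1) matter, and their product takes the value
   sin((2l+2) t) / sin t at 2 cos t. *)

theory Submission
  imports Defs
begin

section \<open>Eigenvalues of the dendrimer as eigenfunctions on its vertices\<close>

lemma sum_neighbours_dendrimer:
  fixes f :: "nat list \<Rightarrow> 'b::comm_monoid_add"
  assumes v: "v \<in> dendrimer_verts l k"
  shows "(\<Sum>w\<in>{w \<in> dendrimer_verts l k. (v, w) \<in> parcs (dendrimer l k)}. f w) =
    (if v = [] then 0 else f (butlast v)) +
    (if length v < l then \<Sum>c<(if v = [] then k else k - 1). f (v @ [c]) else 0)"
proof -
  define C where "C = (\<lambda>c. v @ [c]) ` {c. length v < l \<and> c < (if v = [] then k else k - 1)}"
  define P where "P = (if v = [] then {} else {butlast v})"
  have P_iff: "q \<in> P \<longleftrightarrow> (\<exists>c. v = q @ [c])" for q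
    by (auto simp: P_def) (metis append_butlast_last_id)
  have "butlast v \<in> dendrimer_verts l k"
    using v by (auto simp: dendrimer_verts_def nth_butlast)
  then have "{w \<in> dendrimer_verts l k. (v, w) \<in> parcs (dendrimer l k)} = P \<union> C"
    using v P_iff
    by (auto simp: dendrimer_def C_def snoc_in_dendrimer_verts simp del: append.simps)
  moreover have "P \<inter> C = {}"
    using P_iff by (auto simp: C_def)
  moreover have "finite P" "finite C"
    by (auto simp: C_def P_def)
  ultimately have "(\<Sum>w\<in>{w \<in> dendrimer_verts l k. (v, w) \<in> parcs (dendrimer l k)}. f w) =
      sum f P + sum f C"
    by (simp add: sum.union_disjoint)
  moreover have "sum f C = (\<Sum>c\<in>{c. length v < l \<and> c < (if v = [] then k else k - 1)}. f (v @ [c]))"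
    unfolding C_def by (subst sum.reindex) (auto simp: inj_on_def)
  ultimately show ?thesis
    by (auto simp: P_def lessThan_def)
qed

text \<open>The eigenvalue equation with the neighbour sum already split into parent and children,
  so that it can be solved level by level.\<close>

definition dendrimer_eigenfunction :: "nat \<Rightarrow> nat \<Rightarrow> real \<Rightarrow> (nat list \<Rightarrow> real) \<Rightarrow> bool" where
  "dendrimer_eigenfunction l k x f \<longleftrightarrow>
     (\<exists>v\<in>dendrimer_verts l k. f v \<noteq> 0) \<and>
     (\<forall>v\<in>dendrimer_verts l k.
        (if v = [] then 0 else f (butlast v)) +
        (if length v < l then \<Sum>c<(if v = [] then k else k - 1). f (v @ [c]) else 0) = x * f v)"

lemma sigma_star_dendrimer_iff:
  "x \<in> sigma_star (dendrimer l k) \<longleftrightarrow> (\<exists>f. dendrimer_eigenfunction l k x f)"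
proof -
  obtain vs where vs: "distinct vs" "set vs = dendrimer_verts l k"
    using finite_distinct_list[OF finite_dendrimer_verts] by blast
  then have "sigma_star (dendrimer l k) = spectrum (adjacency_matrix (dendrimer l k) vs)"
    by (intro sigma_star_enum) (auto simp: dendrimer_def)
  then show ?thesis
    using vs by (simp add: spectrum_def eigenvalue_adjacency_matrix_iff sum_neighbours_dendrimer
        dendrimer_eigenfunction_def)
qed

section \<open>Every eigenvalue is a root of some \<open>W l k j\<close>\<close>

lemma poly_W_Suc_Suc:
  "Suc (Suc j) \<le> l \<Longrightarrow>
     poly (W l k (Suc (Suc j))) x = x * poly (W l k (Suc j)) x - (real k - 1) * poly (W l k j) x"
  by simp

text \<open>The recurrence in the form met at a vertex of level \<open>m\<close>. Here
  \<open>0 < m\<close> keeps the index at most \<open>l\<close>, so the weight is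
  \<open>k - 1\<close>, and \<open>m < l\<close> keeps the subtraction \<open>l - Suc m\<close> from
  being truncated.\<close>

lemma poly_W_level:
  assumes "0 < m" "m < l"
  shows "poly (W l k (Suc (l - m))) x =
    x * poly (W l k (l - m)) x - (real k - 1) * poly (W l k (l - Suc m)) x"
proof -
  have "l - m = Suc (l - Suc m)" using assms by simp
  then show ?thesis using assms poly_W_Suc_Suc[of "l - Suc m" l k x] by simp
qed

lemma poly_W_top:
  assumes "l \<ge> 1"
  shows "poly (W l k (Suc l)) x = x * poly (W l k l) x - real k * poly (W l k (l - 1)) x"
  using assms by (cases l) auto

text \<open>Induction from the leaves upwards: multiplying the equation at \<open>v\<close> by the
  polynomial of index \<open>j + 1\<close> turns each of the \<open>k - 1\<close> child terms into
  the same multiple of \<open>f v\<close>, and the recurrence remains. Avoiding division keeps this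
  valid where the polynomials vanish at \<open>x\<close>.\<close>

lemma dendrimer_eigenfunction_parent:
  assumes f: "dendrimer_eigenfunction l k x f" and k: "k \<ge> 1"
    and v: "v \<in> dendrimer_verts l k" "v \<noteq> []" "length v + j = l"
  shows "poly (W l k (Suc j)) x * f v = poly (W l k j) x * f (butlast v)"
  using v
proof (induction j arbitrary: v)
  case 0
  then have "f (butlast v) = x * f v"
    using f by (auto simp: dendrimer_eigenfunction_def dest!: bspec)
  then show ?case by simp
next
  case (Suc j)
  have child: "poly (W l k (Suc j)) x * f (v @ [c]) = poly (W l k j) x * f v" if "c < k - 1" for c
    using Suc.IH[of "v @ [c]"] Suc.prems that by (simp add: snoc_in_dendrimer_verts)
  have eq: "f (butlast v) + (\<Sum>c<k - 1. f (v @ [c])) = x * f v"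
    using f Suc.prems by (auto simp: dendrimer_eigenfunction_def dest!: bspec[of _ _ v])
  then have "poly (W l k (Suc j)) x * (x * f v) =
      poly (W l k (Suc j)) x * f (butlast v) + (\<Sum>c<k - 1. poly (W l k (Suc j)) x * f (v @ [c]))"
    unfolding eq[symmetric] by (simp add: distrib_left sum_distrib_left)
  also have "(\<Sum>c<k - 1. poly (W l k (Suc j)) x * f (v @ [c])) =
      (real k - 1) * (poly (W l k j) x * f v)"
    using k by (simp add: child of_nat_diff)
  \<comment> \<open>Since \<open>v\<close> is not the root, \<open>j + 2 \<le> l\<close>, so the
    recurrence has weight \<open>k - 1\<close>.\<close>
  finally show ?case
    using Suc.prems by (subst poly_W_Suc_Suc) (auto simp: algebra_simps Suc_le_eq)
qed

text \<open>The same elimination with the \<open>k\<close> children of the root; this is what the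
  weight \<open>k\<close> in the last recurrence step encodes.\<close>

lemma dendrimer_eigenfunction_root:
  assumes f: "dendrimer_eigenfunction l k x f" and "k \<ge> 1" "l \<ge> 1"
  shows "poly (W l k (Suc l)) x * f [] = 0"
proof -
  have root: "[] \<in> dendrimer_verts l k"
    by (simp add: dendrimer_verts_def)
  have child: "poly (W l k l) x * f [c] = poly (W l k (l - 1)) x * f []" if "c < k" for c
    using dendrimer_eigenfunction_parent[OF assms(1,2), of "[c]" "l - 1"] that root assms(3)
      snoc_in_dendrimer_verts[of "[]" c l k] by simp
  have "(\<Sum>c<k. f [c]) = x * f []"
    using f root assms(3) by (auto simp: dendrimer_eigenfunction_def dest!: bspec[of _ _ "[]"])
  then have "poly (W l k l) x * (x * f []) = (\<Sum>c<k. poly (W l k l) x * f [c])"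
    by (simp flip: sum_distrib_left)
  also have "\<dots> = real k * (poly (W l k (l - 1)) x * f [])"
    by (simp add: child)
  finally show ?thesis
    by (simp add: poly_W_top[OF assms(3)] algebra_simps)
qed

text \<open>If \<open>f\<close> vanishes at the root, take \<open>v\<close> of minimal level with
  \<open>f v \<noteq> 0\<close>. Its parent \<open>p\<close> has \<open>f p = 0\<close>, so the
  relation between parent and child forces the polynomial of index \<open>l - length p\<close> to
  vanish at \<open>x\<close>.\<close>

lemma dendrimer_eigenfunction_imp_root:
  assumes f: "dendrimer_eigenfunction l k x f" and k: "k \<ge> 2" and l: "l \<ge> 1"
  shows "poly (W l k (Suc l)) x = 0 \<or>
    (\<exists>j. 1 \<le> j \<and> j \<le> l \<and> (k = 2 \<longrightarrow> j = l) \<and> poly (W l k j) x = 0)"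
proof (cases "f [] = 0")
  case False
  then show ?thesis using dendrimer_eigenfunction_root[OF f] k l by simp
next
  case True
  obtain u where "u \<in> dendrimer_verts l k \<and> f u \<noteq> 0"
    using f by (auto simp: dendrimer_eigenfunction_def)
  then obtain v where v: "v \<in> dendrimer_verts l k" "f v \<noteq> 0"
    and min: "\<And>w. w \<in> dendrimer_verts l k \<Longrightarrow> f w \<noteq> 0 \<Longrightarrow> length v \<le> length w"
    using ex_has_least_nat[of "\<lambda>v. v \<in> dendrimer_verts l k \<and> f v \<noteq> 0" u length] by blast
  then obtain p c where p: "v = p @ [c]"
    using True by (metis append_butlast_last_id)
  have verts: "p \<in> dendrimer_verts l k" "length p < l" "c < (if p = [] then k else k - 1)"
    using v by (auto simp: p snoc_in_dendrimer_verts)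
  have fp: "f p = 0"
    using min[of p] verts by (auto simp: p)
  have "Suc (l - length v) = l - length p"
    using verts by (simp add: p)
  then have root: "poly (W l k (l - length p)) x = 0"
    using dendrimer_eigenfunction_parent[OF f _ v(1), of "l - length v"] k v verts fp
    by (simp add: p)
  \<comment> \<open>Below the root each inner vertex has a single child if \<open>k = 2\<close>. By
    minimality \<open>f\<close> vanishes at \<open>p\<close> and at its parent, so the equation at
    \<open>p\<close> would give \<open>f v = 0\<close>.\<close>
  have "p = []" if "k = 2"
  proof (rule ccontr)
    assume "p \<noteq> []"
    then have "butlast p \<in> dendrimer_verts l k" "length (butlast p) < length v"
      using verts by (auto simp: dendrimer_verts_def nth_butlast p)
    then have "f (butlast p) = 0"
      using min by fastforce
    moreover have "f (butlast p) + f (p @ [0]) = x * f p"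
      using f verts \<open>p \<noteq> []\<close> that by (auto simp: dendrimer_eigenfunction_def dest!: bspec[of _ _ p])
    ultimately show False
      using v fp verts \<open>p \<noteq> []\<close> that by (simp add: p)
  qed
  then show ?thesis
    using root verts by (intro disjI2 exI[of _ "l - length p"]) auto
qed

section \<open>Every such root is an eigenvalue: explicit eigenfunctions\<close>

lemma dendrimer_eigenfunction_symmetric:
  assumes "poly (W l k (Suc l)) x = 0" and k: "k \<ge> 2" and l: "l \<ge> 1"
  shows "dendrimer_eigenfunction l k x (\<lambda>v. poly (W l k (l - length v)) x)"
  unfolding dendrimer_eigenfunction_def
\<comment> \<open>At a leaf the function takes the value \<open>W l k 0 = 1\<close>.\<close>
proof (intro conjI bexI[of _ "replicate l 0"] ballI)
  show "replicate l 0 \<in> dendrimer_verts l k"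
    using k by (auto simp: dendrimer_verts_def)
  fix v assume v: "v \<in> dendrimer_verts l k"
  show "(if v = [] then 0 else poly (W l k (l - length (butlast v))) x) +
      (if length v < l then \<Sum>c<(if v = [] then k else k - 1). poly (W l k (l - length (v @ [c]))) x
       else 0) = x * poly (W l k (l - length v)) x"
  \<comment> \<open>At the root the equation is the assumed vanishing of
    \<open>W l k (Suc l)\<close> at \<open>x\<close>; at inner vertices it is the recurrence, and at
    leaves it is the value \<open>x\<close> of the polynomial of index 1.\<close>
  proof (cases "v = []")
    case True
    then show ?thesis using assms(1) l by (simp add: poly_W_top[OF l])
  next
    case False
    then have "l - length (butlast v) = Suc (l - length v)"
      using v by (cases v rule: rev_cases) (auto simp: dendrimer_verts_def)
    moreover have "l = length v" if "\<not> length v < l"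
      using v that by (simp add: dendrimer_verts_def)
    ultimately show ?thesis
      using False k poly_W_level[of "length v" l k x]
      by (cases "length v < l") (simp_all add: of_nat_diff)
  qed
qed simp

text \<open>The branches below the children 0 and 1 of the vertex \<open>replicate (l - j) 0\<close> carry opposite signs.\<close>

lemma dendrimer_eigenfunction_antisymmetric:
  assumes root: "poly (W l k j) x = 0" and j: "1 \<le> j" "j \<le> l"
    and k: "k \<ge> 2" "k = 2 \<Longrightarrow> j = l"
  defines "s \<equiv> \<lambda>v. if l - j < length v \<and> take (l - j) v = replicate (l - j) 0
                   then (if v ! (l - j) = 0 then 1 else if v ! (l - j) = 1 then -1 else 0) else 0 :: real"
  shows "dendrimer_eigenfunction l k x (\<lambda>v. s v * poly (W l k (l - length v)) x)"
  unfolding dendrimer_eigenfunction_def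
proof (intro conjI bexI[of _ "replicate l 0"] ballI)
  show "replicate l 0 \<in> dendrimer_verts l k"
    using k by (auto simp: dendrimer_verts_def)
  \<comment> \<open>As \<open>j \<ge> 1\<close>, this leaf lies in the branch of child 0 and carries
    the sign 1.\<close>
  show "s (replicate l 0) * poly (W l k (l - length (replicate l 0))) x \<noteq> 0"
    using j by (simp add: s_def)
  fix v assume v: "v \<in> dendrimer_verts l k"
  consider "length v < l - j" | "length v = l - j" | "length v > l - j" by linarith
  then show "(if v = [] then 0 else s (butlast v) * poly (W l k (l - length (butlast v))) x) +
      (if length v < l then \<Sum>c<(if v = [] then k else k - 1).
         s (v @ [c]) * poly (W l k (l - length (v @ [c]))) x
       else 0) = x * (s v * poly (W l k (l - length v)) x)"
  proof cases
    case 1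
    then show ?thesis by (auto simp: s_def)
  next
    case 2
    define b where "b = (if v = [] then k else k - 1)"
    \<comment> \<open>Two sibling branches exist: for \<open>k \<ge> 3\<close> below any inner
      vertex, and for \<open>k = 2\<close> because \<open>j = l\<close> makes \<open>v\<close> the
      root.\<close>
    have "b \<ge> 2"
      using 2 k j unfolding b_def by (cases "k = 2") auto
    then have "(\<Sum>c<b. s (v @ [c])) = 0"
    proof -
      have "(\<Sum>c<b. s (v @ [c])) = (\<Sum>c\<in>{0, 1}. s (v @ [c]))"
        using \<open>b \<ge> 2\<close> 2 by (intro sum.mono_neutral_right) (auto simp: s_def nth_append)
      also have "\<dots> = 0"
        using 2 by (simp add: s_def nth_append)
      finally show ?thesis .
    qed
    then have "(\<Sum>c<b. s (v @ [c]) * poly (W l k (l - length (v @ [c]))) x) = 0"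
      by (simp flip: sum_distrib_right)
    moreover have "s w = 0" if "length w \<le> l - j" for w
      using that by (simp add: s_def)
    then have "s v = 0" "s (butlast v) = 0"
      using 2 by simp_all
    ultimately show ?thesis
      unfolding b_def by simp
  next
    case 3
    then have ne: "v \<noteq> []" by auto
    then have len: "l - length (butlast v) = Suc (l - length v)"
      using v by (cases v rule: rev_cases) (auto simp: dendrimer_verts_def)
    have child: "s (v @ [c]) = s v" for c
      using 3 by (simp add: s_def nth_append)
    \<comment> \<open>At the top of a branch the parent carries 0 although \<open>s v\<close> may be
      nonzero; the two sides still agree because \<open>x\<close> is a root of
      \<open>W l k j\<close>. Further down the sign is inherited.\<close>
    have parent: "s (butlast v) * poly (W l k (l - length (butlast v))) x =
        s v * poly (W l k (Suc (l - length v))) x"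
    proof (cases "length v = Suc (l - j)")
      case True
      then have "Suc (l - length v) = j" using j by auto
      then show ?thesis unfolding len using root by simp
    next
      case False
      then have "s (butlast v) = s v"
        using 3 by (cases v rule: rev_cases) (auto simp: s_def nth_append)
      then show ?thesis unfolding len by simp
    qed
    have "l = length v" if "\<not> length v < l"
      using v that by (simp add: dendrimer_verts_def)
    then show ?thesis
      using ne k poly_W_level[of "length v" l k x] unfolding child parent
      by (cases "length v < l") (simp_all add: of_nat_diff right_diff_distrib mult.left_commute)
  qed
qed

text \<open>The condition on \<open>j\<close> covers both cases of the theorem at once: for
  \<open>k = 2\<close> only the root has sibling branches below it, which leaves
  \<open>j = l\<close>.\<close>

lemma sigma_star_dendrimer_eq_roots:
  assumes "k \<ge> 2" "l \<ge> 1"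
  shows "sigma_star (dendrimer l k) =
    (\<Union>j\<in>{j. 1 \<le> j \<and> j \<le> l \<and> (k = 2 \<longrightarrow> j = l)}. {x. poly (W l k j) x = 0}) \<union>
    {x. poly (W l k (Suc l)) x = 0}"
proof (intro subset_antisym subsetI)
  fix x assume "x \<in> sigma_star (dendrimer l k)"
  then show "x \<in> (\<Union>j\<in>{j. 1 \<le> j \<and> j \<le> l \<and> (k = 2 \<longrightarrow> j = l)}. {x. poly (W l k j) x = 0}) \<union>
    {x. poly (W l k (Suc l)) x = 0}"
    using dendrimer_eigenfunction_imp_root[of l k x] assms
    unfolding sigma_star_dendrimer_iff by blast
next
  fix x assume "x \<in> (\<Union>j\<in>{j. 1 \<le> j \<and> j \<le> l \<and> (k = 2 \<longrightarrow> j = l)}. {x. poly (W l k j) x = 0}) \<union>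
    {x. poly (W l k (Suc l)) x = 0}"
  then show "x \<in> sigma_star (dendrimer l k)"
    using dendrimer_eigenfunction_symmetric[of l k x] dendrimer_eigenfunction_antisymmetric[of l k _ x] assms
    unfolding sigma_star_dendrimer_iff by blast
qed

section \<open>Roots of the polynomials \<open>W l k j\<close>\<close>

lemma degree_W_le: "degree (W l k j) \<le> j"
proof (induction l k j rule: W.induct)
  case (3 l k j)
  have "degree ([:0, 1:] * W l k (Suc j)) \<le> Suc (Suc j)"
    using degree_mult_le[of "[:0, 1:]" "W l k (Suc j)"] "3.IH"(1) by simp
  moreover have "degree (Polynomial.smult c (W l k j)) \<le> Suc (Suc j)" for c
    using degree_smult_le[of c "W l k j"] "3.IH"(2) by linarith
  ultimately show ?case
    unfolding W.simps by (intro degree_diff_le)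
qed auto

text \<open>Ensures that \<open>W l k j\<close> is nonzero, as root counting requires.\<close>

lemma coeff_W_self: "coeff (W l k j) j = 1"
proof (induction l k j rule: W.induct)
  case (3 l k j)
  have "coeff (W l k j) (Suc (Suc j)) = 0"
    using degree_W_le[of l k j] by (intro coeff_eq_0) simp
  then show ?case using "3.IH" by simp
qed auto

text \<open>A nonzero polynomial has at most as many roots as its degree, so that many known roots
  exhaust them.\<close>

lemma poly_roots_eqI:
  fixes p :: "'a::idom poly"
  assumes "p \<noteq> 0" "degree p \<le> card S" "\<And>x. x \<in> S \<Longrightarrow> poly p x = 0"
  shows "{x. poly p x = 0} = S"
proof -
  have "S \<subseteq> {x. poly p x = 0}" using assms(3) by blast
  moreover have "card {x. poly p x = 0} \<le> card S"
    using card_poly_roots_bound[OF assms(1)] assms(2) by linarith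
  ultimately show ?thesis
    using card_seteq[OF poly_roots_finite[OF assms(1)]] by blast
qed

text \<open>All angles lie between 0 and \<open>pi\<close>, where cosine is injective; hence the
  image has exactly \<open>n\<close> elements.\<close>

lemma inj_on_cos_multiples:
  fixes a :: real
  assumes "a \<noteq> 0"
  shows "inj_on (\<lambda>h::nat. a * cos (real h / (real n + 1) * pi)) {1..n}"
proof (rule inj_onI)
  fix h i assume hi: "h \<in> {1..n}" "i \<in> {1..n}"
    and eq: "a * cos (real h / (real n + 1) * pi) = a * cos (real i / (real n + 1) * pi)"
  have range: "0 \<le> real h / (real n + 1) * pi \<and> real h / (real n + 1) * pi \<le> pi"
    if "h \<in> {1..n}" for h
    using that by (auto simp: divide_simps)
  from eq have "cos (real h / (real n + 1) * pi) = cos (real i / (real n + 1) * pi)"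
    using assms by simp
  then have "real h / (real n + 1) * pi = real i / (real n + 1) * pi"
    by (metis cos_inj_pi hi range)
  then show "h = i" by simp
qed

text \<open>Allows the factor \<open>sin t\<close> to be cancelled at the angles in
  question.\<close>

lemma sin_multiple_pos:
  assumes "h \<in> {1..n}"
  shows "sin (real h / (real n + 1) * pi) > 0"
  using assms by (intro sin_gt_zero) (auto simp: divide_simps)

text \<open>For \<open>j \<le> l\<close> these are rescaled Chebyshev polynomials of the second
  kind: with \<open>r = sqrt (k - 1)\<close>, the value at \<open>2 * r * c\<close> is
  \<open>r ^ j\<close> times \<open>U_j(c)\<close>. The factor \<open>sin t\<close> stands on the
  left to avoid a division.\<close>

lemma poly_W_cos:
  assumes "k \<ge> 1" "j \<le> l"
  shows "poly (W l k j) (2 * sqrt (real k - 1) * cos t) * sin t =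
    sqrt (real k - 1) ^ j * sin ((real j + 1) * t)"
  using assms
proof (induction l k j rule: W.induct)
  case (2 l k)
  have "sin (2 * t) = 2 * sin t * cos t" by (rule sin_double)
  then show ?case by simp
next
  case (3 l k j)
  define r where "r = sqrt (real k - 1)"
  have r2: "real k - 1 = r * r"
    using 3 by (simp add: r_def)
  \<comment> \<open>The middle angle: the outer two are \<open>u + t\<close> and
    \<open>u - t\<close>, whose sines add up to \<open>2 * cos t * sin u\<close>.\<close>
  define u where "u = (real j + 2) * t"
  have "sin ((real j + 3) * t) = sin (u + t)" "sin ((real j + 1) * t) = sin (u - t)"
    by (simp_all add: u_def algebra_simps)
  then have step: "sin ((real j + 3) * t) = 2 * cos t * sin u - sin ((real j + 1) * t)"
    by (simp add: sin_add sin_diff)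
  have "poly (W l k (Suc (Suc j))) (2 * r * cos t) * sin t =
      2 * r * cos t * (poly (W l k (Suc j)) (2 * r * cos t) * sin t)
      - r * r * (poly (W l k j) (2 * r * cos t) * sin t)"
    using 3 by (simp add: algebra_simps flip: r2)
  also have "\<dots> = 2 * r * cos t * (r ^ Suc j * sin u) - r * r * (r ^ j * sin ((real j + 1) * t))"
    using 3 by (simp add: r_def u_def add_ac)
  also have "\<dots> = r ^ Suc (Suc j) * sin ((real j + 3) * t)"
    unfolding step by (simp add: algebra_simps)
  finally show ?case by (simp add: r_def add_ac)
qed simp

text \<open>At \<open>t = h * pi / (j + 1)\<close> the factor \<open>sin ((j + 1) * t)\<close>
  vanishes while \<open>sin t > 0\<close>. This gives \<open>j\<close> distinct roots, which reaches
  the degree bound.\<close>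

lemma roots_W:
  assumes "k \<ge> 2" "j \<le> l"
  shows "{x. poly (W l k j) x = 0} =
    (\<lambda>h. 2 * sqrt (real k - 1) * cos (real h / (real j + 1) * pi)) ` {1..j}"
proof (rule poly_roots_eqI)
  show "W l k j \<noteq> 0" using coeff_W_self[of l k j] by auto
  show "degree (W l k j) \<le>
      card ((\<lambda>h. 2 * sqrt (real k - 1) * cos (real h / (real j + 1) * pi)) ` {1..j})"
    using assms degree_W_le by (subst card_image[OF inj_on_cos_multiples]) auto
  fix x assume "x \<in> (\<lambda>h. 2 * sqrt (real k - 1) * cos (real h / (real j + 1) * pi)) ` {1..j}"
  then obtain h where h: "h \<in> {1..j}"
    and x_eq: "x = 2 * sqrt (real k - 1) * cos (real h / (real j + 1) * pi)" by blast
  define t where "t = real h / (real j + 1) * pi"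
  have x: "x = 2 * sqrt (real k - 1) * cos t"
    unfolding x_eq t_def ..
  have "(real j + 1) * t = real h * pi"
    by (simp add: t_def divide_simps)
  then have "poly (W l k j) x * sin t = 0"
    using poly_W_cos[of k j l t] assms by (simp add: x)
  then show "poly (W l k j) x = 0"
    using sin_multiple_pos[OF h, folded t_def] by simp
qed

text \<open>For \<open>k = 2\<close> the last weight is 2 instead of 1, so the left side is
  \<open>sin ((l + 2) * t) - sin (l * t)\<close>: the polynomial at \<open>2 * c\<close> is twice
  the Chebyshev polynomial of the first kind \<open>T_(l+1)(c)\<close>.\<close>

lemma poly_W_top_cos:
  assumes "l \<ge> 1"
  shows "poly (W l 2 (Suc l)) (2 * cos t) * sin t = 2 * cos ((real l + 1) * t) * sin t"
proof -
  \<comment> \<open>Writing \<open>l * t\<close> as \<open>(l + 1) * t - t\<close> lets the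
    subtraction formula bring both terms to the angle \<open>(l + 1) * t\<close>.\<close>
  have "poly (W l 2 l) (2 * cos t) * sin t = sin ((real l + 1) * t)"
    "poly (W l 2 (l - 1)) (2 * cos t) * sin t = sin ((real l + 1) * t - t)"
    using poly_W_cos[of 2 l l t] poly_W_cos[of 2 "l - 1" l t] assms
    by (simp_all add: of_nat_diff algebra_simps)
  moreover have "poly (W l 2 (Suc l)) (2 * cos t) * sin t =
      2 * cos t * (poly (W l 2 l) (2 * cos t) * sin t)
      - 2 * (poly (W l 2 (l - 1)) (2 * cos t) * sin t)"
    unfolding poly_W_top[OF assms] by (simp add: algebra_simps)
  ultimately have "poly (W l 2 (Suc l)) (2 * cos t) * sin t =
      2 * cos t * sin ((real l + 1) * t) - 2 * sin ((real l + 1) * t - t)"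
    by simp
  then show ?thesis
    unfolding sin_diff by (simp add: algebra_simps)
qed

text \<open>For \<open>k = 2\<close> the dendrimer is a path on \<open>2 * l + 1\<close> vertices.
  Taking the product of the two polynomials allows a single count of \<open>2 * l + 1\<close> roots
  against its degree.\<close>

lemma roots_W_path:
  assumes "l \<ge> 1"
  shows "{x. poly (W l 2 l * W l 2 (Suc l)) x = 0} =
    (\<lambda>h. 2 * cos (real h / (real (2 * l + 1) + 1) * pi)) ` {1..2 * l + 1}"
proof (rule poly_roots_eqI)
  show "W l 2 l * W l 2 (Suc l) \<noteq> 0"
    using coeff_W_self[of l 2 l] coeff_W_self[of l 2 "Suc l"] by auto
  have "degree (W l 2 l * W l 2 (Suc l)) \<le> 2 * l + 1"
    using degree_mult_le[of "W l 2 l" "W l 2 (Suc l)"] degree_W_le[of l 2 l]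
      degree_W_le[of l 2 "Suc l"] by linarith
  then show "degree (W l 2 l * W l 2 (Suc l)) \<le>
      card ((\<lambda>h. 2 * cos (real h / (real (2 * l + 1) + 1) * pi)) ` {1..2 * l + 1})"
    by (subst card_image[OF inj_on_cos_multiples]) auto
  fix x assume "x \<in> (\<lambda>h. 2 * cos (real h / (real (2 * l + 1) + 1) * pi)) ` {1..2 * l + 1}"
  then obtain h where h: "h \<in> {1..2 * l + 1}"
    and x_eq: "x = 2 * cos (real h / (real (2 * l + 1) + 1) * pi)" by blast
  define t where "t = real h / (real (2 * l + 1) + 1) * pi"
  have x: "x = 2 * cos t"
    unfolding x_eq t_def ..
  have "2 * ((real l + 1) * t) = real h * pi"
    by (simp add: t_def divide_simps)
  then have "sin (2 * ((real l + 1) * t)) = 0" by simp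
  \<comment> \<open>By the double angle formula the sine or the cosine of \<open>(l + 1) * t\<close>
    vanishes; the sine kills the first factor, the cosine the second.\<close>
  then have "(poly (W l 2 l) x * sin t) * (poly (W l 2 (Suc l)) x * sin t) = 0"
    using poly_W_cos[of 2 l l t] poly_W_top_cos[OF assms, of t]
    unfolding sin_double x by auto
  then show "poly (W l 2 l * W l 2 (Suc l)) x = 0"
    using sin_multiple_pos[OF h, folded t_def] by auto
qed

section \<open>The spectrum for \<open>k \<ge> 3\<close> and for \<open>k = 2\<close>\<close>

theorem theorem9:
  fixes l k :: nat
  assumes "l \<ge> 1"
  shows "(k \<ge> 3 \<longrightarrow>
           sigma_star (dendrimer l k) =
             {2 * sqrt (real k - 1) * cos (real h / (real j + 1) * pi) | h j :: nat.
                1 \<le> h \<and> h \<le> j \<and> j \<le> l} \<union>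
             {x :: real. poly (W l k (l + 1)) x = 0}) \<and>
         (k = 2 \<longrightarrow>
           sigma_star (dendrimer l k) =
             {2 * cos (real h / (2 * real l + 2) * pi) | h :: nat.
                1 \<le> h \<and> h \<le> 2 * l + 1})"
proof (intro conjI impI)
  assume k: "k \<ge> 3"
  have "sigma_star (dendrimer l k) =
      (\<Union>j\<in>{1..l}. {x. poly (W l k j) x = 0}) \<union> {x. poly (W l k (l + 1)) x = 0}"
    using sigma_star_dendrimer_eq_roots[of k l] k assms by (auto simp del: W.simps)
  also have "(\<Union>j\<in>{1..l}. {x. poly (W l k j) x = 0}) =
      (\<Union>j\<in>{1..l}. (\<lambda>h. 2 * sqrt (real k - 1) * cos (real h / (real j + 1) * pi)) ` {1..j})"
    using k by (intro SUP_cong refl roots_W) auto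
  also have "\<dots> = {2 * sqrt (real k - 1) * cos (real h / (real j + 1) * pi) | h j :: nat.
                1 \<le> h \<and> h \<le> j \<and> j \<le> l}"
    (is "?A = ?B")
  proof (intro subset_antisym subsetI)
    fix x assume "x \<in> ?A"
    then obtain j h where x: "x = 2 * sqrt (real k - 1) * cos (real h / (real j + 1) * pi)"
      and "h \<in> {1..j}" "j \<in> {1..l}"
      by blast
    then have "1 \<le> h" "h \<le> j" "j \<le> l" by auto
    with x show "x \<in> ?B" by blast
  next
    fix x assume "x \<in> ?B"
    then obtain j h where "x = 2 * sqrt (real k - 1) * cos (real h / (real j + 1) * pi)"
      "h \<in> {1..j}" "j \<in> {1..l}"
      by auto
    then show "x \<in> ?A" by blast
  qed
  finally show "sigma_star (dendrimer l k) =
             {2 * sqrt (real k - 1) * cos (real h / (real j + 1) * pi) | h j :: nat.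
                1 \<le> h \<and> h \<le> j \<and> j \<le> l} \<union>
             {x :: real. poly (W l k (l + 1)) x = 0}" .
next
  assume k: "k = 2"
  \<comment> \<open>Only \<open>j = l\<close> remains in the union, and two root sets together are
    the roots of the product.\<close>
  have "sigma_star (dendrimer l k) = {x. poly (W l 2 l * W l 2 (Suc l)) x = 0}"
    using sigma_star_dendrimer_eq_roots[of k l] k assms by (auto simp del: W.simps)
  also have "\<dots> = (\<lambda>h. 2 * cos (real h / (real (2 * l + 1) + 1) * pi)) ` {1..2 * l + 1}"
    by (rule roots_W_path[OF assms])
  also have "\<dots> = {2 * cos (real h / (2 * real l + 2) * pi) | h :: nat.
                1 \<le> h \<and> h \<le> 2 * l + 1}"
    by (auto simp: add_ac)
  finally show "sigma_star (dendrimer l k) =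
             {2 * cos (real h / (2 * real l + 2) * pi) | h :: nat.
                1 \<le> h \<and> h \<le> 2 * l + 1}" .
qed

end
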